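(* Let $n\ge 2$, let $(q,m)$, $q=(q_1,\dots,q_n)$, $m=(m_1,\dots,m_n)$, be a planar balanced collisionless central configuration, and suppose that the primaries are in the associated rigid motion. Then there is a synchronous solution if and only if there exists $c\in\mathbb{R}$ such that the points $(0,0,c),q_1,\dots,q_n$ associated to the masses $0,m_1,\dots,m_n$ form a pyramidal central configuration.
   Context: The masses $m_1,\dots,m_n$ are positive, $q_1,\dots,q_n$ are pairwise distinct points of the plane $\Pi=\{z=0\}\subset\mathbb{R}^3$, center of mass at the origin, gravitational constant $1$. Central configuration (CC) with constant $\lambda$: for positive masses, $\nabla_jU(q)+\lambda m_jq_j=0$ for all $j$, where $U(q)=\sum_{i<j}\frac{m_im_j}{|q_i-q_j|}$; equivalently $\sum_{i\neq j}\frac{m_i(q_i-q_j)}{|q_i-q_j|^3}=-\lambda q_j$ for all $j$. When some masses are zero, a CC is defined by this second form, required for all $j$ (including the massless bodies) with a common $\lambda$. Pyramidal central configuration (PCC): a CC of $n+1$ points $q_0,q_1,\dots,q_n$ in $\mathbb{R}^3$ such that $q_1,\dots,q_n$ lie in some plane $\Pi$ and $q_0\notin\Pi$. Balanced: for every $r>0$ such that $F_r:=\{i:|q_i|=r\}\ne\emptyset$, $\sum_{i\in F_r}m_iq_i=0$. Collisionless: $q_i\neq0$ for $i=1,\dots,n$. Rigid motion: $x_j(t)=Q(\sqrt\lambda\,t)q_j$, with $Q(\theta)$ the rotation by angle $\theta$ about the $z$-axis; its minimal period is $T=2\pi/\sqrt\lambda$. Synchronous solution: a nonconstant periodic solution $z(t)$,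 with minimal period $T$, of the equation of motion of the massless particle on the $z$-axis, $\ddot z=-\sum_{i=1}^n\frac{m_iz}{(|q_i|^2+z^2)^{3/2}}$. *)

theory Defs
  imports "HOL-Analysis.Analysis"
begin

section \<open>Central configurations\<close>

text \<open>
  The bodies are indexed by a finite set \<open>I\<close> of natural numbers. The equations are used in the form
  \[ \sum_{i \neq j} \frac{m_i (q_i - q_j)}{|q_i - q_j|^3} = - \lambda q_j, \]
  which is meaningful also when some of the masses vanish. For positive masses it is
  equivalent to the variational form; see \<open>central_configuration_iff_gradient\<close> below.
\<close>

definition central_configuration ::
  "nat set \<Rightarrow> (nat \<Rightarrow> real) \<Rightarrow> (nat \<Rightarrow> real^3) \<Rightarrow> real \<Rightarrow> bool" where
  "central_configuration I m q lam \<longleftrightarrow>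
     inj_on q I \<and>
     (\<forall>j\<in>I. (\<Sum>i\<in>I - {j}. (m i / norm (q i - q j) ^ 3) *\<^sub>R (q i - q j)) = - lam *\<^sub>R q j)"

definition potential :: "nat set \<Rightarrow> (nat \<Rightarrow> real) \<Rightarrow> (nat \<Rightarrow> real^3) \<Rightarrow> real" where
  "potential I m q = (\<Sum>j\<in>I. \<Sum>i\<in>{i\<in>I. i < j}. m i * m j / norm (q i - q j))"

text \<open>The apex is the body of index \<open>0\<close>.\<close>

definition pyramidal_central_configuration ::
  "nat \<Rightarrow> (nat \<Rightarrow> real) \<Rightarrow> (nat \<Rightarrow> real^3) \<Rightarrow> bool" where
  "pyramidal_central_configuration n m q \<longleftrightarrow>
     (\<exists>lam. central_configuration {0..n} m q lam) \<and>
     (\<exists>P. affine P \<and> aff_dim P = 2 \<and> q ` {1..n} \<subseteq> P \<and> q 0 \<notin> P)"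

definition balanced :: "nat set \<Rightarrow> (nat \<Rightarrow> real) \<Rightarrow> (nat \<Rightarrow> real^3) \<Rightarrow> bool" where
  "balanced I m q \<longleftrightarrow>
     (\<forall>r>0. {i\<in>I. norm (q i) = r} \<noteq> {} \<longrightarrow> (\<Sum>i\<in>{i\<in>I. norm (q i) = r}. m i *\<^sub>R q i) = 0)"

definition collisionless :: "nat set \<Rightarrow> (nat \<Rightarrow> real^3) \<Rightarrow> bool" where
  "collisionless I q \<longleftrightarrow> (\<forall>i\<in>I. q i \<noteq> 0)"


section \<open>Rigid motion and synchronous solutions\<close>

definition minimal_period :: "(real \<Rightarrow> 'a) \<Rightarrow> real \<Rightarrow> bool" where
  "minimal_period f T \<longleftrightarrow>
     0 < T \<and> (\<forall>t. f (t + T) = f t) \<and> (\<forall>S. 0 < S \<and> S < T \<longrightarrow> (\<exists>t. f (t + S) \<noteq> f t))"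

definition rotation_z :: "real \<Rightarrow> real^3^3" where
  "rotation_z \<theta> = vector [vector [cos \<theta>, - sin \<theta>, 0],
                          vector [sin \<theta>,   cos \<theta>, 0],
                          vector [0,       0,       1]]"

definition rigid_motion :: "nat set \<Rightarrow> real \<Rightarrow> (nat \<Rightarrow> real^3) \<Rightarrow> real \<Rightarrow> nat \<Rightarrow> real^3" where
  "rigid_motion I lam q t = (\<lambda>j\<in>I. rotation_z (sqrt lam * t) *v q j)"

definition axis_solution ::
  "nat set \<Rightarrow> (nat \<Rightarrow> real) \<Rightarrow> (nat \<Rightarrow> real^3) \<Rightarrow> (real \<Rightarrow> real) \<Rightarrow> bool" where
  "axis_solution I m q z \<longleftrightarrow>
     (\<exists>v. \<forall>t. (z has_real_derivative v t) (at t) \<and>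
              (v has_real_derivative
                 - (\<Sum>i\<in>I. m i * z t / ((norm (q i))\<^sup>2 + (z t)\<^sup>2) powr (3/2))) (at t))"

definition synchronous_solution ::
  "nat set \<Rightarrow> (nat \<Rightarrow> real) \<Rightarrow> (nat \<Rightarrow> real^3) \<Rightarrow> real \<Rightarrow> (real \<Rightarrow> real) \<Rightarrow> bool" where
  "synchronous_solution I m q T z \<longleftrightarrow>
     axis_solution I m q z \<and> \<not> (\<exists>k. \<forall>t. z t = k) \<and> minimal_period z T"


section \<open>Consistency of the definitions\<close>

lemma GDERIV_sum:
  assumes "\<And>i. i \<in> A \<Longrightarrow> GDERIV (f i) x :> d i"
  shows "GDERIV (\<lambda>x. \<Sum>i\<in>A. f i x) x :> (\<Sum>i\<in>A. d i)"
  using assms unfolding gderiv_def inner_sum_right by (intro has_derivative_sum) auto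

lemma GDERIV_unique:
  assumes "GDERIV f x :> d" "GDERIV f x :> e"
  shows "d = e"
proof -
  have "(\<lambda>h. inner h d) = (\<lambda>h. inner h e)"
    using assms unfolding gderiv_def by (rule has_derivative_unique)
  then have "\<forall>h. inner h (d - e) = 0"
    by (auto simp: inner_diff_right dest: fun_cong)
  then show ?thesis by (metis inner_eq_zero_iff right_minus_eq)
qed

lemma GDERIV_pair:
  fixes a x :: "'a::real_inner"
  assumes "x \<noteq> a"
  shows "GDERIV (\<lambda>x. k / norm (a - x)) x :> (k / norm (a - x) ^ 3) *\<^sub>R (a - x)"
proof -
  have ne: "a - x \<noteq> 0" using assms by simp
  have 1: "((\<lambda>x. norm (a - x)) has_derivative (\<lambda>h. inner (- h) (sgn (a - x)))) (at x)"
  proof (rule has_derivative_compose[where g = norm])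
    show "((\<lambda>x. a - x) has_derivative uminus) (at x)"
      by (auto intro!: derivative_eq_intros)
  qed (rule has_derivative_norm[OF ne])
  have "((\<lambda>x. k / norm (a - x)) has_derivative
          (\<lambda>h. - k * inner (- h) (sgn (a - x)) / (norm (a - x))\<^sup>2)) (at x)"
    using ne by (auto intro!: derivative_eq_intros 1 simp: power2_eq_square field_simps)
  moreover have "- k * inner (- h) (sgn (a - x)) / (norm (a - x))\<^sup>2
      = inner h ((k / norm (a - x) ^ 3) *\<^sub>R (a - x))" for h
    by (simp add: sgn_div_norm power2_eq_square power3_eq_cube divide_inverse ac_simps
        del: scaleR_right_diff_distrib)
  ultimately show ?thesis unfolding gderiv_def by simp
qed

lemma GDERIV_potential:
  assumes fin: "finite I" and inj: "inj_on q I" and j: "j \<in> I"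
  shows "GDERIV (\<lambda>x. potential I m (q(j := x))) (q j) :>
           (\<Sum>i\<in>I - {j}. (m i * m j / norm (q i - q j) ^ 3) *\<^sub>R (q i - q j))"
proof -
  define g where "g i = (m i * m j / norm (q i - q j) ^ 3) *\<^sub>R (q i - q j)" for i
  define d where "d k i = (if k = j then g i else if i = j then g k else 0)" for k i
  have ne: "q j \<noteq> q i" if "i \<in> I" "i \<noteq> j" for i
    using inj j that by (auto dest: inj_onD)
  have "GDERIV (\<lambda>x. m i * m k / norm ((q(j := x)) i - (q(j := x)) k)) (q j) :> d k i"
    if "k \<in> I" "i \<in> I" "i < k" for k i
  proof -
    consider "k = j" "i \<noteq> j" | "i = j" "k \<noteq> j" | "k \<noteq> j" "i \<noteq> j"
      using \<open>i < k\<close> by blast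
    then show ?thesis
    proof cases
      case 1
      then show ?thesis using GDERIV_pair[OF ne[OF that(2)]] by (simp add: d_def g_def)
    next
      case 2
      then show ?thesis using GDERIV_pair[OF ne[OF that(1)], of "m k * m j"]
        by (simp add: d_def g_def norm_minus_commute mult.commute)
    next
      case 3
      then show ?thesis by (simp add: d_def GDERIV_const)
    qed
  qed
  then have G: "GDERIV (\<lambda>x. potential I m (q(j := x))) (q j) :> (\<Sum>k\<in>I. \<Sum>i\<in>{i\<in>I. i < k}. d k i)"
    unfolding potential_def by (intro GDERIV_sum) auto
  have inner: "(\<Sum>i\<in>{i\<in>I. i < k}. d k i) = (if j < k then g k else 0)" if "k \<noteq> j" for k
    using fin j that by (auto simp: d_def sum.delta)
  have "(\<Sum>k\<in>I. \<Sum>i\<in>{i\<in>I. i < k}. d k i)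
      = (\<Sum>i\<in>{i\<in>I. i < j}. g i) + (\<Sum>k\<in>I - {j}. if j < k then g k else 0)"
    using fin j inner by (subst sum.remove[of I j]) (auto simp: d_def)
  also have "(\<Sum>k\<in>I - {j}. if j < k then g k else 0) = (\<Sum>k\<in>{k\<in>I. j < k}. g k)"
    using fin by (intro sum.mono_neutral_cong_right) auto
  also have "(\<Sum>i\<in>{i\<in>I. i < j}. g i) + (\<Sum>k\<in>{k\<in>I. j < k}. g k) = (\<Sum>i\<in>I - {j}. g i)"
    using fin by (subst sum.union_disjoint[symmetric]) (auto intro!: sum.cong)
  finally show ?thesis using G by (simp add: g_def)
qed

text \<open>The variational form \<open>\<nabla>\<^sub>j U(q) + \<lambda> m\<^sub>j q\<^sub>j = 0\<close>.\<close>

lemma central_configuration_iff_gradient: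
  assumes fin: "finite I" and pos: "\<And>i. i \<in> I \<Longrightarrow> 0 < m i"
  shows "central_configuration I m q lam \<longleftrightarrow>
           inj_on q I \<and>
           (\<forall>j\<in>I. \<exists>D. GDERIV (\<lambda>x. potential I m (q(j := x))) (q j) :> D \<and>
                       D + (lam * m j) *\<^sub>R q j = 0)"
proof -
  have "(\<exists>D. GDERIV (\<lambda>x. potential I m (q(j := x))) (q j) :> D \<and> D + (lam * m j) *\<^sub>R q j = 0)
      \<longleftrightarrow> (\<Sum>i\<in>I - {j}. (m i / norm (q i - q j) ^ 3) *\<^sub>R (q i - q j)) = - lam *\<^sub>R q j"
    (is "?L \<longleftrightarrow> ?S = _") if "inj_on q I" "j \<in> I" for j
  proof -
    have eq: "(\<Sum>i\<in>I - {j}. (m i * m j / norm (q i - q j) ^ 3) *\<^sub>R (q i - q j)) = m j *\<^sub>R ?S"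
      by (simp add: scaleR_right.sum mult.commute)
    have "?L \<longleftrightarrow> m j *\<^sub>R ?S + (lam * m j) *\<^sub>R q j = 0"
      using GDERIV_potential[OF fin that, of m] GDERIV_unique unfolding eq by blast
    also have "m j *\<^sub>R ?S + (lam * m j) *\<^sub>R q j = m j *\<^sub>R (?S + lam *\<^sub>R q j)"
      by (simp add: scaleR_add_right mult.commute)
    also have "\<dots> = 0 \<longleftrightarrow> ?S = - lam *\<^sub>R q j"
      using pos[OF that(2)] by (simp add: eq_neg_iff_add_eq_0)
    finally show ?thesis .
  qed
  then show ?thesis unfolding central_configuration_def by auto
qed

lemma central_configuration_lam_pos:
  assumes cc: "central_configuration I m q lam" and fin: "finite I" and two: "2 \<le> card I"
    and pos: "\<And>i. i \<in> I \<Longrightarrow> 0 < m i"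
  shows "0 < lam"
proof -
  define a where "a i j = m i * m j / norm (q i - q j) ^ 3" for i j
  have E: "(\<Sum>i\<in>I. a i j * ((q i - q j) \<bullet> q j)) = - lam * (m j * (q j \<bullet> q j))" if "j \<in> I" for j
  proof -
    have "(\<Sum>i\<in>I. a i j * ((q i - q j) \<bullet> q j))
        = (\<Sum>i\<in>I - {j}. m j * (((m i / norm (q i - q j) ^ 3) *\<^sub>R (q i - q j)) \<bullet> q j))"
      using fin that by (subst sum.remove[of I j]) (auto simp: a_def intro!: sum.cong)
    also have "\<dots> = m j * ((\<Sum>i\<in>I - {j}. (m i / norm (q i - q j) ^ 3) *\<^sub>R (q i - q j)) \<bullet> q j)"
      by (simp add: inner_sum_left sum_distrib_left)
    also have "\<dots> = m j * ((- lam *\<^sub>R q j) \<bullet> q j)"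
      using cc that by (simp add: central_configuration_def)
    finally show ?thesis by (simp add: algebra_simps)
  qed
  define X where "X = (\<Sum>j\<in>I. \<Sum>i\<in>I. a i j * ((q i - q j) \<bullet> q j))"
  have X: "X = - lam * (\<Sum>j\<in>I. m j * (q j \<bullet> q j))"
    unfolding X_def by (simp add: E sum_distrib_left)
  have a_sym: "a i j = a j i" for i j by (simp add: a_def norm_minus_commute mult.commute)
  have "X = (\<Sum>j\<in>I. \<Sum>i\<in>I. a i j * ((q j - q i) \<bullet> q i))"
    unfolding X_def by (subst sum.swap) (simp add: a_sym)
  then have "2 * X = (\<Sum>j\<in>I. \<Sum>i\<in>I. a i j * ((q i - q j) \<bullet> q j) + a i j * ((q j - q i) \<bullet> q i))"
    unfolding sum.distrib using X_def by simp
  also have "\<dots> = (\<Sum>j\<in>I. \<Sum>i\<in>I. - (a i j * ((q i - q j) \<bullet> (q i - q j))))"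
    by (intro sum.cong refl) (simp add: algebra_simps inner_commute)
  finally have X2: "2 * X = - (\<Sum>j\<in>I. \<Sum>i\<in>I. a i j * ((q i - q j) \<bullet> (q i - q j)))"
    by (simp add: sum_negf)
  have nn: "0 \<le> a i j * ((q i - q j) \<bullet> (q i - q j))" if "i \<in> I" "j \<in> I" for i j
    using pos[OF that(1)] pos[OF that(2)] by (simp add: a_def)
  obtain k l where kl: "k \<in> I" "l \<in> I" "k \<noteq> l"
    using two by (metis card_le_Suc0_iff_eq fin not_less_eq_eq numeral_2_eq_2)
  have "q k \<noteq> q l" using cc kl by (auto simp: central_configuration_def dest: inj_onD)
  then have "0 < a k l * ((q k - q l) \<bullet> (q k - q l))"
    using pos kl by (simp add: a_def)
  then have "0 < (\<Sum>i\<in>I. a i l * ((q i - q l) \<bullet> (q i - q l)))"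
    using fin kl nn by (intro sum_pos2[of I k]) auto
  then have "0 < (\<Sum>j\<in>I. \<Sum>i\<in>I. a i j * ((q i - q j) \<bullet> (q i - q j)))"
    using fin kl(2) nn by (intro sum_pos2[of I l "\<lambda>j. \<Sum>i\<in>I. a i j * ((q i - q j) \<bullet> (q i - q j))"] sum_nonneg)
  then have "0 < lam * (\<Sum>j\<in>I. m j * (q j \<bullet> q j))" using X X2 by simp
  moreover have "0 \<le> (\<Sum>j\<in>I. m j * (q j \<bullet> q j))"
    using pos by (intro sum_nonneg) (simp add: less_imp_le)
  ultimately show ?thesis by (simp add: zero_less_mult_iff)
qed

lemma rotation_z_mult:
  "rotation_z \<theta> *v p = vector [cos \<theta> * p$1 - sin \<theta> * p$2, sin \<theta> * p$1 + cos \<theta> * p$2, p$3]"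
  by (simp add: rotation_z_def matrix_vector_mult_def vec_eq_iff forall_3 sum_3)

lemma minimal_period_unique:
  assumes "minimal_period f S" "minimal_period f T"
  shows "S = T"
  using assms unfolding minimal_period_def by (metis linorder_neqE)

lemma rigid_motion_minimal_period:
  assumes lam: "0 < lam" and j: "j \<in> I" "q j \<noteq> 0" "q j $ 3 = 0"
  shows "minimal_period (rigid_motion I lam q) T \<longleftrightarrow> T = 2 * pi / sqrt lam"
proof -
  have "rigid_motion I lam q (t + 2 * pi / sqrt lam) = rigid_motion I lam q t" for t
    using lam by (simp add: rigid_motion_def rotation_z_mult distrib_left)
  moreover have "rigid_motion I lam q (0 + S) \<noteq> rigid_motion I lam q 0"
    if S: "0 < S" "S < 2 * pi / sqrt lam" for S
  proof
    let ?c = "cos (sqrt lam * S)" and ?s = "sin (sqrt lam * S)"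
    let ?x = "q j $ 1" and ?y = "q j $ 2"
    assume "rigid_motion I lam q (0 + S) = rigid_motion I lam q 0"
    then have "rigid_motion I lam q (0 + S) j = rigid_motion I lam q 0 j" by simp
    then have e: "?c * ?x - ?s * ?y = ?x" "?s * ?x + ?c * ?y = ?y"
      using j by (auto simp: rigid_motion_def rotation_z_mult vec_eq_iff forall_3)
    have "(?c - 1) * (?x\<^sup>2 + ?y\<^sup>2) = ?x * (?c * ?x - ?s * ?y - ?x) + ?y * (?s * ?x + ?c * ?y - ?y)"
      by (simp add: algebra_simps power2_eq_square)
    also have "\<dots> = 0" using e by simp
    finally have "?c = 1 \<or> ?x\<^sup>2 + ?y\<^sup>2 = 0" by simp
    moreover have "?x\<^sup>2 + ?y\<^sup>2 \<noteq> 0"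
      using j by (auto simp: vec_eq_iff forall_3 sum_power2_eq_zero_iff)
    ultimately have "?c = 1" by blast
    then obtain k :: int where k: "sqrt lam * S = of_int k * 2 * pi"
      by (auto simp: cos_one_2pi_int)
    have "0 < sqrt lam * S" "sqrt lam * S < 2 * pi"
      using S lam by (auto simp: field_simps)
    then have "0 < real_of_int k * (2 * pi)" "real_of_int k * (2 * pi) < 1 * (2 * pi)"
      using k by (auto simp: algebra_simps)
    then have "0 < real_of_int k" "real_of_int k < 1"
      by (simp_all only: zero_less_mult_iff mult_less_cancel_right) auto
    then show False by simp
  qed
  ultimately have "minimal_period (rigid_motion I lam q) (2 * pi / sqrt lam)"
    using lam unfolding minimal_period_def by (metis divide_pos_pos mult_pos_pos pi_gt_zero
        real_sqrt_gt_zero zero_less_numeral)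
  then show ?thesis using minimal_period_unique by blast
qed

end

theory Submission
  imports Defs
begin

text \<open>
  Write the equation on the axis as \<open>z'' = - k(z) z\<close>, where \<open>k(z) = \<Sum> m\<^sub>i / (|q\<^sub>i|\<^sup>2 + z\<^sup>2)\<^bsup>3/2\<^esup>\<close> is
  even, strictly decreasing in \<open>|z|\<close> and tends to \<open>0\<close>. Since the configuration is balanced, an apex
  of mass \<open>0\<close> at height \<open>c\<close> completes it to a pyramidal central configuration iff \<open>c \<noteq> 0\<close> and
  \<open>k(c) = \<lambda>\<close>; such a \<open>c\<close> exists iff \<open>\<lambda> < k(0)\<close>. The same condition governs synchronous solutions.
  If \<open>k(0) \<le> \<lambda>\<close>, Sturm comparison with \<open>sin (\<surd>\<lambda> t)\<close> shows that a solution keeps opposite signs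
  for time \<open>T/2\<close> after and before a zero, so it is not \<open>T\<close>-periodic. If \<open>\<lambda> < k(0)\<close>, the period as a
  function of the amplitude is continuous, tends to \<open>2\<pi>/\<surd>k(0) < T\<close> for small oscillations and is
  unbounded, so it takes the value \<open>T\<close>.
\<close>

section \<open>Real analysis: roots, comparison and quadrature for scalar equations\<close>

lemma powr_three_halves:
  fixes x :: real
  assumes "0 \<le> x"
  shows "x powr (3/2) = sqrt x ^ 3"
proof (cases "x = 0")
  case False
  then have "sqrt x ^ 3 = (x powr (1/2)) powr 3"
    using assms by (simp add: powr_half_sqrt powr_numeral)
  then show ?thesis using assms by (simp add: powr_powr)
qed simp

text \<open>The positive slope at \<open>a\<close> keeps \<open>f\<close> positive on a short
  interval to the right, so roots cannot accumulate at \<open>a\<close> from that side, and a least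
  later point with \<open>f \<le> 0\<close> exists by compactness.\<close>

lemma first_root_after:
  fixes f :: "real \<Rightarrow> real"
  assumes der: "(f has_real_derivative d) (at a)" and "0 < d" and "f a = 0"
    and cont: "\<And>x. isCont f x" and "a < b" and "f b \<le> 0"
  obtains s where "a < s" "s \<le> b" "f s = 0" "\<And>x. a < x \<Longrightarrow> x < s \<Longrightarrow> 0 < f x"
proof -
  obtain e where e: "0 < e" "\<And>h. 0 < h \<Longrightarrow> h < e \<Longrightarrow> 0 < f (a + h)"
    using DERIV_pos_inc_right[OF der \<open>0 < d\<close>] \<open>f a = 0\<close> by auto
  \<comment> \<open>Starting at \<open>a + e/2\<close> keeps the root \<open>a\<close> itself out of
    the set while skipping only points where \<open>f\<close> is positive.\<close>
  define S where "S = {x \<in> {a + e/2..b}. f x \<le> 0}"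
  have "closed S"
    unfolding S_def
    by (intro continuous_closed_preimage_constant continuous_on_closed_Collect_le continuous_on_const
        continuous_at_imp_continuous_on ballI cont closed_atLeastAtMost)
  then have "compact S"
    unfolding S_def by (metis (no_types, lifting) bounded_closed_interval bounded_subset
        compact_eq_bounded_closed mem_Collect_eq subsetI)
  moreover have be: "a + e \<le> b"
    using e(2)[of "b - a"] assms by (cases "a + e \<le> b") auto
  then have "b \<in> S" using e assms by (auto simp: S_def)
  ultimately obtain s where s: "s \<in> S" "\<And>x. x \<in> S \<Longrightarrow> s \<le> x"
    using compact_attains_inf[of S] by blast
  have pos: "0 < f x" if "a < x" "x < s" for x
  proof (cases "x < a + e/2")
    case True
    then show ?thesis using e(2)[of "x - a"] that e(1) by simp
  next
    case False
    show ?thesis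
    proof (rule ccontr)
      assume "\<not> 0 < f x"
      then have "x \<in> S" using False that s(1) by (auto simp: S_def)
      then show False using s(2)[of x] that by simp
    qed
  qed
  have as: "a < s" using s(1) e(1) by (auto simp: S_def)
  \<comment> \<open>The minimum only gives \<open>f s \<le> 0\<close>; the reverse inequality is the
    left limit of positive values.\<close>
  have "0 \<le> f s"
  proof (rule tendsto_lowerbound)
    show "(f \<longlongrightarrow> f s) (at_left s)"
      using cont[of s] by (simp add: isCont_def filterlim_at_split)
    show "\<forall>\<^sub>F x in at_left s. 0 \<le> f x"
      using eventually_at_left_real[OF as] by eventually_elim (use pos in \<open>auto intro: less_imp_le\<close>)
  qed simp
  then have "f s = 0" using s(1) by (auto simp: S_def)
  with that as pos s(1) show ?thesis by (auto simp: S_def)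
qed

text \<open>Sturm comparison with \<open>sin (\<omega> t)\<close>, via the Wronskian.\<close>

lemma sturm_pos:
  fixes z v \<kappa> :: "real \<Rightarrow> real"
  assumes z: "\<And>t. (z has_real_derivative v t) (at t)"
    and v: "\<And>t. (v has_real_derivative - (\<kappa> t * z t)) (at t)"
    and \<kappa>: "\<And>t. z t \<noteq> 0 \<Longrightarrow> \<kappa> t < \<omega>\<^sup>2"
    and "0 < \<omega>" "z 0 = 0" "0 < v 0" and t: "0 < t" "t \<le> pi / \<omega>"
  shows "0 < z t"
proof (rule ccontr)
  assume "\<not> 0 < z t"
  then have "z t \<le> 0" by simp
  then obtain s where s: "0 < s" "s \<le> t" "z s = 0" and pos: "\<And>x. 0 < x \<Longrightarrow> x < s \<Longrightarrow> 0 < z x"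
    by (rule first_root_after[OF z[of 0] \<open>0 < v 0\<close> \<open>z 0 = 0\<close> DERIV_isCont[OF z] t(1)]) blast
  \<comment> \<open>The Wronskian of \<open>z\<close> and the comparison solution increases as long
    as \<open>z\<close> and the sine are both positive, because \<kappa> stays below the square of
    \<omega>.\<close>
  define W where "W x = v x * sin (\<omega> * x) - z x * (\<omega> * cos (\<omega> * x))" for x
  have dW: "(W has_real_derivative (\<omega>\<^sup>2 - \<kappa> x) * z x * sin (\<omega> * x)) (at x)" for x
    unfolding W_def by (auto intro!: derivative_eq_intros z v simp: algebra_simps power2_eq_square)
  have spi: "\<omega> * s \<le> pi" 
    using mult_left_mono[of s "pi / \<omega>" \<omega>] s t \<open>0 < \<omega>\<close> by auto
  have "W 0 < W s"
  proof (rule DERIV_pos_imp_increasing_open[OF \<open>0 < s\<close>])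
    fix x assume x: "0 < x" "x < s"
    then have "\<omega> * x < \<omega> * s" using \<open>0 < \<omega>\<close> by simp
    then have "\<omega> * x < pi" using spi by linarith
    then have "0 < sin (\<omega> * x)" using x \<open>0 < \<omega>\<close> by (intro sin_gt_zero) auto
    then show "\<exists>y. (W has_real_derivative y) (at x) \<and> 0 < y"
      using dW[of x] pos[OF x] \<kappa>[of x] by fastforce
  qed (use dW in \<open>auto intro: DERIV_isCont continuous_at_imp_continuous_on\<close>)
  \<comment> \<open>Both \<open>z\<close> and the sine vanish at 0, so \<open>W 0 = 0\<close>, and
    \<open>z s = 0\<close> leaves only the first term of \<open>W s\<close>. A positive slope at
    \<open>s\<close> is absurd, since \<open>z\<close> reaches that root from above.\<close>
  then have "0 < v s * sin (\<omega> * s)" using s \<open>z 0 = 0\<close> by (simp add: W_def)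
  moreover have "0 \<le> sin (\<omega> * s)" using spi s \<open>0 < \<omega>\<close> by (intro sin_ge_zero) auto
  ultimately have "0 < v s" by (simp add: zero_less_mult_iff)
  then obtain d where d: "0 < d" "\<And>h. 0 < h \<Longrightarrow> h < d \<Longrightarrow> z (s - h) < z s"
    using DERIV_pos_inc_left[OF z[of s]] by blast
  define h where "h = min d s / 2"
  have "0 < h" "h < d" "h < s" using d(1) s(1) by (auto simp: h_def)
  then show False using d(2)[of h] pos[of "s - h"] s by simp
qed

text \<open>Without a root \<open>z\<close> has constant sign, hence so does its second derivative;
  then \<open>v\<close> is strictly monotone, although it takes the same value at 0 and at
  \<open>T\<close>.\<close>

lemma periodic_sublinear_has_root:
  fixes z v \<kappa> :: "real \<Rightarrow> real"
  assumes z: "\<And>t. (z has_real_derivative v t) (at t)"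
    and v: "\<And>t. (v has_real_derivative - (\<kappa> t * z t)) (at t)"
    and \<kappa>: "\<And>t. 0 < \<kappa> t" and "0 < T" and per: "\<And>t. z (t + T) = z t"
  shows "\<exists>t. z t = 0"
proof (rule ccontr)
  assume nz: "\<nexists>t. z t = 0"
  have "((\<lambda>t. z (t + T)) has_real_derivative v T) (at 0)"
    using z[of T] DERIV_shift[of z "v T" 0 T] by simp
  then have vT: "v T = v 0" using z[of 0] per by (simp add: DERIV_unique)
  have cont: "isCont z x" for x using z DERIV_isCont by blast
  have same: "0 < z x \<longleftrightarrow> 0 < z 0" for x
  proof -
    have "\<exists>y. z y = 0" if "z a < 0" "0 < z b" for a b
      using IVT'[of z a 0 b] IVT2'[of z a 0 b] that cont
      by (metis continuous_at_imp_continuous_on less_imp_le linorder_linear)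
    then show ?thesis using nz by (metis linorder_neqE_linordered_idom)
  qed
  show False
  proof (cases "0 < z 0")
    case True
    have "v T < v 0"
    proof (rule DERIV_neg_imp_decreasing[OF \<open>0 < T\<close>], intro exI conjI)
      fix x show "(v has_real_derivative - (\<kappa> x * z x)) (at x)" by (rule v)
      show "- (\<kappa> x * z x) < 0" using \<kappa>[of x] same[of x] True by simp
    qed
    then show False using vT by simp
  next
    case False
    have "v 0 < v T"
    proof (rule DERIV_pos_imp_increasing[OF \<open>0 < T\<close>], intro exI conjI)
      fix x show "(v has_real_derivative - (\<kappa> x * z x)) (at x)" by (rule v)
      have "z x < 0" using same[of x] False nz by (metis linorder_neqE_linordered_idom)
      then show "0 < - (\<kappa> x * z x)" using \<kappa>[of x] by (simp add: mult_pos_neg)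
    qed
    then show False using vT by simp
  qed
qed

text \<open>Sturm comparison from the root \<open>t0\<close>, forwards and in reversed time, gives
  \<open>z\<close> opposite signs half a period after and half a period before \<open>t0\<close>.
  These two times differ by one full period.\<close>

lemma periodic_oscillation_rate:
  fixes z v \<kappa> :: "real \<Rightarrow> real"
  assumes z: "\<And>t. (z has_real_derivative v t) (at t)"
    and v: "\<And>t. (v has_real_derivative - (\<kappa> t * z t)) (at t)"
    and \<kappa>: "\<And>t. z t \<noteq> 0 \<Longrightarrow> \<kappa> t < \<omega>\<^sup>2"
    and "0 < \<omega>" "z t0 = 0" "v t0 \<noteq> 0" and per: "\<And>t. z (t + 2 * pi / \<omega>) = z t"
  shows False
proof -
  \<comment> \<open>The factor \<open>s\<close> is the sign of \<open>v t0\<close>: it makes the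
    initial velocity positive for both the forward solution and the negated time reversal.\<close>
  have key: False if "0 < s * v t0" "s = 1 \<or> s = -1" for s
  proof -
    have "0 < s * z (t0 + pi / \<omega>)"
    proof (rule sturm_pos[of "\<lambda>t. s * z (t0 + t)" "\<lambda>t. s * v (t0 + t)" "\<lambda>t. \<kappa> (t0 + t)"])
      show "((\<lambda>t. s * z (t0 + t)) has_real_derivative s * v (t0 + t)) (at t)" for t
        by (auto intro!: derivative_eq_intros DERIV_chain2[of z] z)
      show "((\<lambda>t. s * v (t0 + t)) has_real_derivative - (\<kappa> (t0 + t) * (s * z (t0 + t)))) (at t)" for t
        by (auto intro!: derivative_eq_intros DERIV_chain2[of v] v)
    qed (use assms that in auto)
    moreover have "0 < - s * z (t0 - pi / \<omega>)"
    proof (rule sturm_pos[of "\<lambda>t. - s * z (t0 - t)" "\<lambda>t. s * v (t0 - t)" "\<lambda>t. \<kappa> (t0 - t)"])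
      show "((\<lambda>t. - s * z (t0 - t)) has_real_derivative s * v (t0 - t)) (at t)" for t
        by (auto intro!: derivative_eq_intros DERIV_chain2[of z] z)
      show "((\<lambda>t. s * v (t0 - t)) has_real_derivative - (\<kappa> (t0 - t) * (- s * z (t0 - t)))) (at t)" for t
        by (auto intro!: derivative_eq_intros DERIV_chain2[of v] v)
    qed (use assms that in auto)
    moreover have "z (t0 + pi / \<omega>) = z (t0 - pi / \<omega>)"
      using per[of "t0 - pi / \<omega>"] by (simp add: algebra_simps)
    ultimately show False by simp
  qed
  show False using key[of 1] key[of "-1"] \<open>v t0 \<noteq> 0\<close> by linarith
qed

text \<open>A positive periodic field on the circle is solved by quadrature: the phase is the inverse
  of an antiderivative of \<open>1 / f\<close>.\<close>

lemma phase_flow: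
  fixes f :: "real \<Rightarrow> real"
  assumes cont: "\<And>x. isCont f x" and pos: "\<And>x. 0 < f x" and bd: "\<And>x. f x \<le> C"
    and per: "\<And>x. f (x + p) = f x" and "0 < p"
  obtains \<phi> where "\<And>t. (\<phi> has_real_derivative f (\<phi> t)) (at t)" "strict_mono \<phi>" "surj \<phi>"
    "\<And>t. \<phi> (t + integral {0..p} (\<lambda>x. 1 / f x)) = \<phi> t + p"
proof -
  \<comment> \<open>Infinite endpoints give one antiderivative on the whole line; \<open>F x\<close>
    is the time at which the phase equals \<open>x\<close>.\<close>
  have "\<exists>F. \<forall>x. - \<infinity> < ereal x \<longrightarrow> ereal x < \<infinity> \<longrightarrow>
      (F has_vector_derivative 1 / f x) (at x)"
    using pos by (intro einterval_antiderivative continuous_intros cont) (auto simp: less_imp_neq[symmetric])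
  then obtain F where F: "(F has_real_derivative 1 / f x) (at x)" for x
    by (auto simp: has_real_derivative_iff_has_vector_derivative)
  have F_mono: "F x < F y" if "x < y" for x y
    using F pos by (intro DERIV_pos_imp_increasing[OF that]) (meson zero_less_divide_1_iff)
  then have "strict_mono F" by (simp add: strict_mono_def)
  have C: "0 < C" using pos[of 0] bd[of 0] by simp
  \<comment> \<open>The upper bound on \<open>f\<close> makes \<open>F\<close> grow at least
    linearly with slope \<open>1 / C\<close>. Hence \<open>F\<close> is onto, and its inverse is
    defined for all times.\<close>
  have grow: "F x - x / C \<le> F y - y / C" if "x \<le> y" for x y
  proof (rule DERIV_nonneg_imp_nondecreasing[OF that], intro exI conjI)
    fix u
    show "((\<lambda>x. F x - x / C) has_real_derivative 1 / f u - 1 / C) (at u)"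
      using C by (auto intro!: derivative_eq_intros F)
    show "0 \<le> 1 / f u - 1 / C" using pos[of u] bd[of u] C by (simp add: field_simps)
  qed
  have F_cont: "isCont F x" for x using F DERIV_isCont by blast
  have "\<exists>x. F x = y" for y
  proof -
    define h where "h = C * \<bar>y - F 0\<bar>"
    have "0 \<le> h" "h / C = \<bar>y - F 0\<bar>" using C by (auto simp: h_def)
    then have "F (- h) \<le> y" "y \<le> F h" "- h \<le> h" using grow[of 0 h] grow[of "- h" 0] by auto
    then show ?thesis using IVT'[of F "- h" y h] F_cont continuous_at_imp_continuous_on by blast
  qed
  then have "surj F" by (metis surjI)
  moreover have "inj F" using \<open>strict_mono F\<close> by (rule strict_mono_imp_inj_on)
  ultimately have FI: "F (inv F t) = t" "inv F (F x) = x" for t x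
    by (auto simp: surj_f_inv_f)
  have I_cont: "isCont (inv F) t" for t
    using isCont_inverse_function[of 1 "inv F t" "inv F" F] F_cont FI by auto
  have 1: "(inv F has_real_derivative f (inv F t)) (at t)" for t
    using DERIV_inverse_function[where f = F and g = "inv F" and x = t and a = "t - 1" and b = "t + 1",
        OF F[of "inv F t"]] pos[of "inv F t"] FI I_cont by auto
  have 2: "strict_mono (inv F)"
    using \<open>strict_mono F\<close> FI by (metis strict_mono_def strict_mono_less)
  have 3: "surj (inv F)" using FI by (metis surjI)
  \<comment> \<open>By periodicity the time for a phase advance of \<open>p\<close> is independent
    of the starting phase; the fundamental theorem identifies it with the integral over one
    period.\<close>
  have "((\<lambda>x. F (x + p) - F x) has_real_derivative 0) (at x)" for x
    using per[of x] by (auto intro!: derivative_eq_intros F DERIV_chain2[of F])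
  then have shift: "F (x + p) - F x = F (0 + p) - F 0" for x
    using DERIV_isconst_all[of "\<lambda>x. F (x + p) - F x" x 0] by blast
  have "((\<lambda>x. 1 / f x) has_integral F p - F 0) {0..p}"
    using \<open>0 < p\<close> F by (intro fundamental_theorem_of_calculus)
      (auto simp: has_real_derivative_iff_has_vector_derivative[symmetric] intro: DERIV_subset)
  then have J: "integral {0..p} (\<lambda>x. 1 / f x) = F p - F 0" by blast
  have 4: "inv F (t + integral {0..p} (\<lambda>x. 1 / f x)) = inv F t + p" for t
    using shift[of "inv F t"] FI J by (metis add.commute add_0 diff_add_cancel)
  from that[OF 1 2 3 4] show ?thesis .
qed

section \<open>The force field on the axis\<close>

locale axial_field =
  fixes I :: "'i set" and m r :: "'i \<Rightarrow> real"
  assumes finite_I: "finite I" and nonempty_I: "I \<noteq> {}"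
    and mass_pos: "i \<in> I \<Longrightarrow> 0 < m i" and radius_pos: "i \<in> I \<Longrightarrow> 0 < r i"
begin

definition stiffness :: "real \<Rightarrow> real" where
  "stiffness z = (\<Sum>i\<in>I. m i / sqrt ((r i)\<^sup>2 + z\<^sup>2) ^ 3)"

text \<open>This is the Newtonian potential energy per unit mass of the particle on the axis, so the
  equation of motion reads \<open>z'' = - V'(z)\<close> with \<open>V\<close> this function.\<close>

definition potential_on_axis :: "real \<Rightarrow> real" where
  "potential_on_axis z = - (\<Sum>i\<in>I. m i / sqrt ((r i)\<^sup>2 + z\<^sup>2))"

text \<open>With the amplitude \<open>A\<close> and the substitution \<open>z = A * sin \<theta>\<close>, conservation of energy
  divided by \<open>(A * cos \<theta>)\<^sup>2\<close> turns into \<open>\<theta>'\<^sup>2 = phase_speed_sq A \<theta>\<close>, without singularity at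
  the turning points.\<close>

definition phase_speed_sq :: "real \<Rightarrow> real \<Rightarrow> real" where
  "phase_speed_sq A \<theta> = (\<Sum>i\<in>I. 2 * m i /
     (sqrt ((r i)\<^sup>2 + (A * sin \<theta>)\<^sup>2) * sqrt ((r i)\<^sup>2 + A\<^sup>2) *
      (sqrt ((r i)\<^sup>2 + (A * sin \<theta>)\<^sup>2) + sqrt ((r i)\<^sup>2 + A\<^sup>2))))"

lemma dist_pos: "i \<in> I \<Longrightarrow> 0 < (r i)\<^sup>2 + x\<^sup>2"
  using radius_pos[of i] by (simp add: add_pos_nonneg)

lemma sqrt_ge: "i \<in> I \<Longrightarrow> r i \<le> sqrt ((r i)\<^sup>2 + x\<^sup>2)" "\<bar>x\<bar> \<le> sqrt ((r i)\<^sup>2 + x\<^sup>2)"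
  by (auto intro: real_le_rsqrt)

lemma sqrt_dist_neq_0: "i \<in> I \<Longrightarrow> sqrt ((r i)\<^sup>2 + x\<^sup>2) \<noteq> 0"
  using dist_pos[of i x] by (simp only: real_sqrt_eq_0_iff less_imp_neq[symmetric] not_False_eq_True)

lemma sqrt_dist_less: "x \<noteq> 0 \<Longrightarrow> sqrt ((r i)\<^sup>2 + 0\<^sup>2) < sqrt ((r i)\<^sup>2 + x\<^sup>2)"
  by (simp only: real_sqrt_less_iff) simp

lemma stiffness_pos: "0 < stiffness z"
  unfolding stiffness_def
  by (intro sum_pos finite_I nonempty_I divide_pos_pos mass_pos zero_less_power) (auto simp: dist_pos)

lemma stiffness_less:
  assumes "z \<noteq> 0"
  shows "stiffness z < stiffness 0"
  unfolding stiffness_def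
proof (rule sum_strict_mono[OF finite_I nonempty_I])
  fix i assume i: "i \<in> I"
  have "sqrt ((r i)\<^sup>2 + 0\<^sup>2) ^ 3 < sqrt ((r i)\<^sup>2 + z\<^sup>2) ^ 3"
    using sqrt_dist_less[OF assms] by (intro power_strict_mono) auto
  then show "m i / sqrt ((r i)\<^sup>2 + z\<^sup>2) ^ 3 < m i / sqrt ((r i)\<^sup>2 + 0\<^sup>2) ^ 3"
    using mass_pos[OF i] radius_pos[OF i] dist_pos[OF i] by (intro divide_strict_left_mono) auto
qed

lemma stiffness_cont: "continuous_on UNIV stiffness"
  unfolding stiffness_def by (intro continuous_intros) (simp add: sqrt_dist_neq_0 del: real_sqrt_eq_0_iff)

lemma potential_deriv: "(potential_on_axis has_real_derivative stiffness z * z) (at z)"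
proof -
  have "((\<lambda>z. - (m i / sqrt ((r i)\<^sup>2 + z\<^sup>2))) has_real_derivative m i / sqrt ((r i)\<^sup>2 + z\<^sup>2) ^ 3 * z) (at z)"
    if "i \<in> I" for i
    using dist_pos[OF that, of z]
    by (auto intro!: derivative_eq_intros simp: field_simps power2_eq_square power3_eq_cube)
  then have "((\<lambda>z. \<Sum>i\<in>I. - (m i / sqrt ((r i)\<^sup>2 + z\<^sup>2))) has_real_derivative
     (\<Sum>i\<in>I. m i / sqrt ((r i)\<^sup>2 + z\<^sup>2) ^ 3 * z)) (at z)"
    by (intro DERIV_sum)
  then show ?thesis
    by (simp add: potential_on_axis_def[abs_def] stiffness_def sum_negf sum_distrib_right)
qed

lemma potential_min:
  assumes "z \<noteq> 0"
  shows "potential_on_axis 0 < potential_on_axis z"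
  unfolding potential_on_axis_def neg_less_iff_less
proof (rule sum_strict_mono[OF finite_I nonempty_I])
  fix i assume i: "i \<in> I"
  then show "m i / sqrt ((r i)\<^sup>2 + z\<^sup>2) < m i / sqrt ((r i)\<^sup>2 + 0\<^sup>2)"
    using sqrt_dist_less[OF assms] mass_pos[OF i] radius_pos[OF i] dist_pos[OF i]
    by (intro divide_strict_left_mono) (auto simp del: power_zero_numeral)
qed

text \<open>Both quantities are \<open>O(1 / A^2)\<close>: in each denominator one factor is bounded
  below by \<open>r i\<close> and two by \<open>A\<close>. The common bound serves both to reach a
  prescribed stiffness and to make the period long.\<close>

lemma stiffness_at_amplitude:
  assumes "0 < \<omega>"
  obtains A where "0 < A" "stiffness A \<le> \<omega>\<^sup>2" "\<And>\<theta>. phase_speed_sq A \<theta> \<le> \<omega>\<^sup>2"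
proof -
  define S where "S = (\<Sum>i\<in>I. 2 * m i / r i)"
  have "0 < S"
    unfolding S_def by (intro sum_pos finite_I nonempty_I divide_pos_pos) (auto simp: mass_pos radius_pos)
  \<comment> \<open>Chosen so that the common bound \<open>S / A^2\<close> is exactly the square of
    \<omega>. The factor 2 in \<open>S\<close> comes from \<open>phase_speed_sq\<close>; the
    stiffness estimate just absorbs it.\<close>
  define A where "A = sqrt S / \<omega>"
  have A: "0 < A" using \<open>0 < S\<close> assms by (simp add: A_def)
  have SA: "S / A\<^sup>2 = \<omega>\<^sup>2" using \<open>0 < S\<close> assms by (simp add: A_def power_divide)
  have "stiffness A \<le> (\<Sum>i\<in>I. 2 * m i / r i / A\<^sup>2)"
    unfolding stiffness_def
  proof (rule sum_mono)
    fix i assume i: "i \<in> I"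
    let ?b = "sqrt ((r i)\<^sup>2 + A\<^sup>2)"
    have "r i * A * A \<le> ?b * ?b * ?b"
      using sqrt_ge(1)[OF i, of A] sqrt_ge(2)[of A i] A radius_pos[OF i] by (intro mult_mono) auto
    then have "r i * A\<^sup>2 \<le> ?b ^ 3"
      by (simp only: power2_eq_square power3_eq_cube mult.assoc)
    then have "m i / ?b ^ 3 \<le> m i / (r i * A\<^sup>2)"
      using mass_pos[OF i] radius_pos[OF i] A dist_pos[OF i, of A] by (intro divide_left_mono) auto
    also have "\<dots> \<le> 2 * m i / r i / A\<^sup>2"
      using mass_pos[OF i] radius_pos[OF i] A by (simp add: divide_simps)
    finally show "m i / ?b ^ 3 \<le> 2 * m i / r i / A\<^sup>2" .
  qed
  then have 1: "stiffness A \<le> \<omega>\<^sup>2"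
    unfolding SA[symmetric] S_def sum_divide_distrib .
  have "phase_speed_sq A \<theta> \<le> (\<Sum>i\<in>I. 2 * m i / r i / A\<^sup>2)" for \<theta>
    unfolding phase_speed_sq_def
  proof (rule sum_mono)
    fix i assume i: "i \<in> I"
    let ?a = "sqrt ((r i)\<^sup>2 + (A * sin \<theta>)\<^sup>2)" and ?b = "sqrt ((r i)\<^sup>2 + A\<^sup>2)"
    have ab: "r i \<le> ?a" "A \<le> ?b" "0 < ?a" "0 < ?b"
      using sqrt_ge(1)[OF i] sqrt_ge(2)[of A i] dist_pos[OF i] by auto
    then have "A \<le> ?a + ?b" by linarith
    with ab have "r i * A * A \<le> ?a * ?b * (?a + ?b)"
      using A radius_pos[OF i] by (intro mult_mono) auto
    then have "2 * m i / (?a * ?b * (?a + ?b)) \<le> 2 * m i / (r i * A * A)"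
      using mass_pos[OF i] radius_pos[OF i] A ab
      by (intro divide_left_mono mult_pos_pos add_pos_pos) auto
    then show "2 * m i / (?a * ?b * (?a + ?b)) \<le> 2 * m i / r i / A\<^sup>2"
      by (simp add: power2_eq_square mult.assoc)
  qed
  then have 2: "phase_speed_sq A \<theta> \<le> \<omega>\<^sup>2" for \<theta>
    unfolding SA[symmetric] S_def sum_divide_distrib .
  from that[OF A 1 2] show ?thesis .
qed

text \<open>One direction is the intermediate value theorem between 0 and a large amplitude; the
  other holds because 0 is the strict maximum of \<open>stiffness\<close>.\<close>

lemma stiffness_attains_iff:
  assumes "0 < \<omega>"
  shows "(\<exists>c. c \<noteq> 0 \<and> stiffness c = \<omega>\<^sup>2) \<longleftrightarrow> \<omega>\<^sup>2 < stiffness 0"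
proof
  assume r: "\<omega>\<^sup>2 < stiffness 0"
  obtain A where A: "0 < A" "stiffness A \<le> \<omega>\<^sup>2" using stiffness_at_amplitude[OF assms] .
  then obtain c where "0 \<le> c" "stiffness c = \<omega>\<^sup>2"
    using IVT2'[of stiffness A "\<omega>\<^sup>2" 0] r continuous_on_subset[OF stiffness_cont] by auto
  then show "\<exists>c. c \<noteq> 0 \<and> stiffness c = \<omega>\<^sup>2" using r by (intro exI[of _ c]) auto
next
  assume "\<exists>c. c \<noteq> 0 \<and> stiffness c = \<omega>\<^sup>2"
  then show "\<omega>\<^sup>2 < stiffness 0" using stiffness_less by metis
qed

section \<open>Necessity of the stiffness condition\<close>

text \<open>Conservation of energy bounds the potential along the solution by its strict minimum at
  0, which replaces an appeal to uniqueness for the differential equation.\<close>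

lemma rest_unique:
  assumes z: "\<And>t. (z has_real_derivative v t) (at t)"
    and v: "\<And>t. (v has_real_derivative - (stiffness (z t) * z t)) (at t)"
    and "z t0 = 0" "v t0 = 0"
  shows "z t = 0"
proof -
  define E where "E t = (v t)\<^sup>2 / 2 + potential_on_axis (z t)" for t
  have "(E has_real_derivative 0) (at t)" for t
    unfolding E_def
    by (auto intro!: derivative_eq_intros z v DERIV_chain2[OF potential_deriv])
  then have "E t = E t0" using DERIV_isconst_all by blast
  then have "potential_on_axis (z t) \<le> potential_on_axis 0"
    using assms(3,4) by (simp add: E_def) (smt (verit) zero_le_power2 divide_nonneg_nonneg)
  then show ?thesis using potential_min by force
qed

text \<open>Periodicity forces a root, and nonconstancy a nonzero velocity there. In a soft field
  the oscillation around that root is then too slow for the prescribed period.\<close>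

lemma periodic_solution_imp_stiff:
  assumes z: "\<And>t. (z has_real_derivative v t) (at t)"
    and v: "\<And>t. (v has_real_derivative - (stiffness (z t) * z t)) (at t)"
    and nonconst: "\<not> (\<exists>k. \<forall>t. z t = k)" and "0 < \<omega>" and per: "\<And>t. z (t + 2 * pi / \<omega>) = z t"
  shows "\<omega>\<^sup>2 < stiffness 0"
proof (rule ccontr)
  assume soft: "\<not> \<omega>\<^sup>2 < stiffness 0"
  obtain t0 where t0: "z t0 = 0"
    using periodic_sublinear_has_root[OF z v stiffness_pos _ per] \<open>0 < \<omega>\<close> by auto
  have "v t0 \<noteq> 0" using rest_unique[OF z v t0] nonconst by blast
  show False
  proof (rule periodic_oscillation_rate[OF z v _ \<open>0 < \<omega>\<close> t0 \<open>v t0 \<noteq> 0\<close> per])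
    fix t assume "z t \<noteq> 0"
    then show "stiffness (z t) < \<omega>\<^sup>2" using stiffness_less[of "z t"] soft by simp
  qed
qed

section \<open>Existence of an oscillation with prescribed period\<close>

text \<open>At amplitude 0 the formula reduces to the squared frequency of the linearised motion,
  which is the starting value for the period as a function of \<open>A\<close>.\<close>

lemma phase_speed_sq_0: "phase_speed_sq 0 \<theta> = stiffness 0"
  unfolding phase_speed_sq_def stiffness_def
  by (intro sum.cong refl) (auto simp: power3_eq_cube dest!: radius_pos)

lemma phase_speed_sq_pos: "0 < phase_speed_sq A \<theta>"
  unfolding phase_speed_sq_def
  by (intro sum_pos finite_I nonempty_I divide_pos_pos mult_pos_pos add_pos_pos)
    (auto simp: mass_pos dist_pos)

text \<open>Supplies the uniform upper bound that \<open>phase_flow\<close> asks of the phase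
  speed.\<close>

lemma phase_speed_sq_le: "phase_speed_sq A \<theta> \<le> stiffness 0"
  unfolding phase_speed_sq_def stiffness_def
proof (rule sum_mono)
  fix i assume i: "i \<in> I"
  let ?a = "sqrt ((r i)\<^sup>2 + (A * sin \<theta>)\<^sup>2)" and ?b = "sqrt ((r i)\<^sup>2 + A\<^sup>2)"
  have ab: "r i \<le> ?a" "r i \<le> ?b" "0 < ?a" "0 < ?b"
    using sqrt_ge(1)[OF i] dist_pos[OF i] by auto
  then have "r i * r i * (r i + r i) \<le> ?a * ?b * (?a + ?b)"
    using radius_pos[OF i] by (intro mult_mono add_mono) auto
  then have "2 * m i / (?a * ?b * (?a + ?b)) \<le> 2 * m i / (r i * r i * (r i + r i))"
    using mass_pos[OF i] radius_pos[OF i] ab by (intro divide_left_mono mult_pos_pos add_pos_pos) auto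
  then show "2 * m i / (?a * ?b * (?a + ?b)) \<le> m i / sqrt ((r i)\<^sup>2 + 0\<^sup>2) ^ 3"
    using radius_pos[OF i] by (simp add: power3_eq_cube)
qed

text \<open>Continuity is joint in amplitude and angle, so that the period integral depends
  continuously on the amplitude.\<close>

lemma phase_speed_sq_cont: "continuous_on UNIV (\<lambda>(A, \<theta>). phase_speed_sq A \<theta>)"
proof -
  have "sqrt ((r i)\<^sup>2 + x\<^sup>2) + sqrt ((r i)\<^sup>2 + y\<^sup>2) \<noteq> 0" if "i \<in> I" for i x y
    using dist_pos[OF that, of x] dist_pos[OF that, of y] by (smt (verit) real_sqrt_gt_zero)
  then show ?thesis
    unfolding phase_speed_sq_def split_beta
    by (intro continuous_intros) (use sqrt_dist_neq_0 in \<open>simp only: mult_eq_0_iff fst_conv snd_conv simp_thms ball_simps\<close>)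
qed

lemma phase_speed_sq_deriv:
  "(phase_speed_sq A has_real_derivative
     (\<Sum>i\<in>I. - 2 * m i * A\<^sup>2 * sin \<theta> * cos \<theta> *
        (2 * sqrt ((r i)\<^sup>2 + (A * sin \<theta>)\<^sup>2) + sqrt ((r i)\<^sup>2 + A\<^sup>2)) /
        (sqrt ((r i)\<^sup>2 + (A * sin \<theta>)\<^sup>2) ^ 3 * sqrt ((r i)\<^sup>2 + A\<^sup>2) *
         (sqrt ((r i)\<^sup>2 + (A * sin \<theta>)\<^sup>2) + sqrt ((r i)\<^sup>2 + A\<^sup>2))\<^sup>2))) (at \<theta>)"
  unfolding phase_speed_sq_def[abs_def]
proof (rule DERIV_sum)
  fix i assume i: "i \<in> I"
  define b where "b = sqrt ((r i)\<^sup>2 + A\<^sup>2)"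
  define a where "a \<theta> = sqrt ((r i)\<^sup>2 + (A * sin \<theta>)\<^sup>2)" for \<theta>
  have pos: "0 < a \<theta>" "0 < b" using dist_pos[OF i] by (auto simp: a_def b_def)
  have a: "(a has_real_derivative A\<^sup>2 * sin \<theta> * cos \<theta> / a \<theta>) (at \<theta>)"
    unfolding a_def[abs_def] using dist_pos[OF i, of "A * sin \<theta>"]
    by (auto intro!: derivative_eq_intros simp: field_simps power2_eq_square)
  have "((\<lambda>\<theta>. 2 * m i / (a \<theta> * b * (a \<theta> + b))) has_real_derivative
     - 2 * m i * A\<^sup>2 * sin \<theta> * cos \<theta> * (2 * a \<theta> + b) / (a \<theta> ^ 3 * b * (a \<theta> + b)\<^sup>2)) (at \<theta>)"
    using pos
    by (auto intro!: derivative_eq_intros a) (simp add: divide_simps; simp add: algebra_simps power2_eq_square power3_eq_cube)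
  then show "((\<lambda>\<theta>. 2 * m i / (sqrt ((r i)\<^sup>2 + (A * sin \<theta>)\<^sup>2) * sqrt ((r i)\<^sup>2 + A\<^sup>2) *
      (sqrt ((r i)\<^sup>2 + (A * sin \<theta>)\<^sup>2) + sqrt ((r i)\<^sup>2 + A\<^sup>2)))) has_real_derivative
     - 2 * m i * A\<^sup>2 * sin \<theta> * cos \<theta> *
        (2 * sqrt ((r i)\<^sup>2 + (A * sin \<theta>)\<^sup>2) + sqrt ((r i)\<^sup>2 + A\<^sup>2)) /
        (sqrt ((r i)\<^sup>2 + (A * sin \<theta>)\<^sup>2) ^ 3 * sqrt ((r i)\<^sup>2 + A\<^sup>2) *
         (sqrt ((r i)\<^sup>2 + (A * sin \<theta>)\<^sup>2) + sqrt ((r i)\<^sup>2 + A\<^sup>2))\<^sup>2)) (at \<theta>)"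
    unfolding a_def b_def .
qed

text \<open>The phase equation \<open>\<theta>'\<^sup>2 = phase_speed_sq A \<theta>\<close> differentiated once more.\<close>

lemma phase_speed_sq_equation:
  obtains D where "(phase_speed_sq A has_real_derivative D) (at \<theta>)"
    "cos \<theta> * D / 2 - sin \<theta> * phase_speed_sq A \<theta> = - stiffness (A * sin \<theta>) * sin \<theta>"
proof -
  note that[OF phase_speed_sq_deriv]
  moreover have "cos \<theta> * (- 2 * m i * A\<^sup>2 * sin \<theta> * cos \<theta> * (2 * a + b) / (a ^ 3 * b * (a + b)\<^sup>2)) / 2
      - sin \<theta> * (2 * m i / (a * b * (a + b))) = - (m i / a ^ 3) * sin \<theta>"
    if i: "i \<in> I" and a: "a = sqrt ((r i)\<^sup>2 + (A * sin \<theta>)\<^sup>2)" and b: "b = sqrt ((r i)\<^sup>2 + A\<^sup>2)"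
    for i a b
  proof -
    have pos: "0 < a" "0 < b" using dist_pos[OF i] by (auto simp: a b)
    have "A\<^sup>2 * (cos \<theta>)\<^sup>2 = b\<^sup>2 - a\<^sup>2"
      using dist_pos[OF i] by (simp add: a b cos_squared_eq power_mult_distrib algebra_simps)
    moreover have "cos \<theta> * (- 2 * m i * A\<^sup>2 * sin \<theta> * cos \<theta> * (2 * a + b) / (a ^ 3 * b * (a + b)\<^sup>2)) / 2
       = - (A\<^sup>2 * (cos \<theta>)\<^sup>2) * m i * sin \<theta> * (2 * a + b) / (a ^ 3 * b * (a + b)\<^sup>2)"
      using pos by (simp add: divide_simps; simp add: algebra_simps power2_eq_square)
    ultimately have "cos \<theta> * (- 2 * m i * A\<^sup>2 * sin \<theta> * cos \<theta> * (2 * a + b) / (a ^ 3 * b * (a + b)\<^sup>2)) / 2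
       = - (b\<^sup>2 - a\<^sup>2) * m i * sin \<theta> * (2 * a + b) / (a ^ 3 * b * (a + b)\<^sup>2)"
      by (simp only:)
    \<comment> \<open>The difference of squares factors as \<open>(b - a) * (b + a)\<close> and
      cancels one factor \<open>a + b\<close> of the denominator.\<close>
    also have "\<dots> = - (b - a) * m i * sin \<theta> * (2 * a + b) / (a ^ 3 * b * (a + b))"
      using pos by (simp add: divide_simps; simp add: algebra_simps power2_eq_square)
    also have "\<dots> - sin \<theta> * (2 * m i / (a * b * (a + b))) = - (m i / a ^ 3) * sin \<theta>"
      using pos by (simp add: divide_simps; simp add: algebra_simps power2_eq_square power3_eq_cube)
    finally show ?thesis .
  qed
  ultimately show ?thesis
    by (simp add: phase_speed_sq_def stiffness_def sum_distrib_left sum_distrib_right sum_divide_distrib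
        sum_subtractf[symmetric] sum_negf[symmetric])
qed

text \<open>As \<open>A\<close> grows from \<open>0\<close>, the period \<open>integral {0..2 * pi} (\<lambda>\<theta>. 1 / sqrt (phase_speed_sq A \<theta>))\<close> of the
  oscillation varies continuously from \<open>2 * pi / sqrt (stiffness 0)\<close> to infinity.\<close>

lemma amplitude_of_period:
  assumes "0 < \<omega>" "\<omega>\<^sup>2 < stiffness 0"
  obtains A where "A \<noteq> 0"
    "integral {0..2 * pi} (\<lambda>\<theta>. 1 / sqrt (phase_speed_sq A \<theta>)) = 2 * pi / \<omega>"
proof -
  define P where "P A = integral {0..2 * pi} (\<lambda>\<theta>. 1 / sqrt (phase_speed_sq A \<theta>))" for A
  have cont2: "continuous_on UNIV (\<lambda>(A, \<theta>). 1 / sqrt (phase_speed_sq A \<theta>))"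
    using phase_speed_sq_pos phase_speed_sq_cont unfolding split_beta
    by (intro continuous_intros) (auto simp: less_imp_neq[symmetric])
  then have "continuous_on UNIV (\<lambda>A. integral (cbox 0 (2 * pi)) (\<lambda>\<theta>. 1 / sqrt (phase_speed_sq A \<theta>)))"
    by (intro integral_continuous_on_param) (auto intro: continuous_on_subset)
  then have P_cont: "continuous_on {0..B} P" for B
    unfolding P_def[abs_def] by (auto intro: continuous_on_subset)
  have P0: "P 0 = 2 * pi / sqrt (stiffness 0)"
    by (simp add: P_def phase_speed_sq_0)
  have \<omega>: "\<omega> < sqrt (stiffness 0)" using assms real_less_rsqrt by blast
  then have P0_less: "P 0 < 2 * pi / \<omega>"
    unfolding P0 using \<open>0 < \<omega>\<close> by (intro divide_strict_left_mono mult_pos_pos) (auto simp: stiffness_pos)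
  \<comment> \<open>At this amplitude the phase speed never exceeds \<omega>, so one revolution
    takes at least \<open>2 * pi / \<omega>\<close>.\<close>
  obtain B where B: "0 < B" "\<And>\<theta>. phase_speed_sq B \<theta> \<le> \<omega>\<^sup>2"
    using stiffness_at_amplitude[OF \<open>0 < \<omega>\<close>] by metis
  have "continuous_on {0..2 * pi} (\<lambda>\<theta>. 1 / sqrt (phase_speed_sq B \<theta>))"
    using continuous_on_compose2[OF cont2, of "{0..2 * pi}" "\<lambda>\<theta>. (B, \<theta>)"]
    by (simp add: continuous_on_Pair)
  then have "(\<lambda>\<theta>. 1 / sqrt (phase_speed_sq B \<theta>)) integrable_on {0..2 * pi}"
    by (rule integrable_continuous_real)
  then have "integral {0..2 * pi} (\<lambda>\<theta>. 1 / \<omega>) \<le> P B"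
    unfolding P_def
  proof (rule integral_le[rotated])
    fix \<theta>
    have "sqrt (phase_speed_sq B \<theta>) \<le> \<omega>"
      using B(2)[of \<theta>] \<open>0 < \<omega>\<close> by (intro real_le_lsqrt) (auto intro: less_imp_le phase_speed_sq_pos)
    then show "1 / \<omega> \<le> 1 / sqrt (phase_speed_sq B \<theta>)"
      using \<open>0 < \<omega>\<close> phase_speed_sq_pos by (intro divide_left_mono) auto
  qed (auto intro: integrable_continuous_real)
  then have "2 * pi / \<omega> \<le> P B" by simp
  then obtain A where A: "0 \<le> A" "P A = 2 * pi / \<omega>"
    using IVT'[of P 0 "2 * pi / \<omega>" B] P0_less P_cont B(1) by auto
  then have "A \<noteq> 0" using P0_less by auto
  then show ?thesis using that[of A] A by (simp add: P_def)
qed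

text \<open>An amplitude whose period is \<open>2 * pi / \<omega>\<close> is fixed, and the solution
  is \<open>A * sin\<close> of the phase flow at that amplitude.\<close>

lemma stiff_imp_periodic_solution:
  assumes "0 < \<omega>" "\<omega>\<^sup>2 < stiffness 0"
  obtains z v where "\<And>t. (z has_real_derivative v t) (at t)"
    "\<And>t. (v has_real_derivative - (stiffness (z t) * z t)) (at t)"
    "minimal_period z (2 * pi / \<omega>)"
proof -
  obtain A where A: "A \<noteq> 0"
      "integral {0..2 * pi} (\<lambda>\<theta>. 1 / sqrt (phase_speed_sq A \<theta>)) = 2 * pi / \<omega>"
    using amplitude_of_period[OF assms] .
  define f where "f \<theta> = sqrt (phase_speed_sq A \<theta>)" for \<theta>
  have f_pos: "0 < f \<theta>" and f_sq: "f \<theta> * f \<theta> = phase_speed_sq A \<theta>" for \<theta>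
    using phase_speed_sq_pos[of A \<theta>] by (auto simp: f_def)
  have f_cont: "isCont f \<theta>" for \<theta>
    unfolding f_def[abs_def] using phase_speed_sq_deriv by (intro continuous_intros DERIV_isCont)
  have f_bd: "f \<theta> \<le> sqrt (stiffness 0)" for \<theta>
    using phase_speed_sq_le by (simp add: f_def)
  have f_per: "f (\<theta> + 2 * pi) = f \<theta>" for \<theta>
    by (simp add: f_def phase_speed_sq_def)
  obtain \<phi> where \<phi>: "\<And>t. (\<phi> has_real_derivative f (\<phi> t)) (at t)" "strict_mono \<phi>" "surj \<phi>"
      "\<And>t. \<phi> (t + 2 * pi / \<omega>) = \<phi> t + 2 * pi"
    using phase_flow[OF f_cont f_pos f_bd f_per] A(2) by (auto simp: f_def)
  define z where "z t = A * sin (\<phi> t)" for t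
  define v where "v t = A * (cos (\<phi> t) * f (\<phi> t))" for t
  have 1: "(z has_real_derivative v t) (at t)" for t
    unfolding z_def[abs_def] v_def by (auto intro!: derivative_eq_intros \<phi>(1))
  have 2: "(v has_real_derivative - (stiffness (z t) * z t)) (at t)" for t
  proof -
    obtain D where D: "(phase_speed_sq A has_real_derivative D) (at (\<phi> t))"
      "cos (\<phi> t) * D / 2 - sin (\<phi> t) * phase_speed_sq A (\<phi> t) = - stiffness (A * sin (\<phi> t)) * sin (\<phi> t)"
      by (rule phase_speed_sq_equation)
    \<comment> \<open>The square root brings in a division by \<open>f\<close>, which cancels
      against the phase velocity \<open>f\<close> in the chain rule below.\<close>
    have "(f has_real_derivative D / (2 * f (\<phi> t))) (at (\<phi> t))"
      unfolding f_def[abs_def] using phase_speed_sq_pos[of A "\<phi> t"]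
      by (auto intro!: derivative_eq_intros D(1) simp: field_simps)
    then have "((\<lambda>t. f (\<phi> t)) has_real_derivative D / (2 * f (\<phi> t)) * f (\<phi> t)) (at t)"
      by (rule DERIV_chain2[OF _ \<phi>(1)])
    then have "((\<lambda>t. f (\<phi> t)) has_real_derivative D / 2) (at t)"
      using f_pos[of "\<phi> t"] by simp
    then have "(v has_real_derivative A * (cos (\<phi> t) * (D / 2) + (- sin (\<phi> t) * f (\<phi> t)) * f (\<phi> t))) (at t)"
      unfolding v_def[abs_def] by (auto intro!: derivative_eq_intros \<phi>(1))
    moreover have "A * (cos (\<phi> t) * (D / 2) + (- sin (\<phi> t) * f (\<phi> t)) * f (\<phi> t)) = - (stiffness (z t) * z t)"
    proof -
      have "A * (cos (\<phi> t) * (D / 2) + (- sin (\<phi> t) * f (\<phi> t)) * f (\<phi> t))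
          = A * (cos (\<phi> t) * D / 2 - sin (\<phi> t) * phase_speed_sq A (\<phi> t))"
        by (simp add: f_sq[symmetric])
      then show ?thesis unfolding D(2) by (simp add: z_def)
    qed
    ultimately show ?thesis by simp
  qed
  \<comment> \<open>At this phase the sine equals 1. It next returns to 1 after a phase advance of
    \<open>2 * pi\<close>, which by strict monotonicity takes the whole time
    \<open>2 * pi / \<omega>\<close>, so no smaller period exists.\<close>
  obtain t0 where t0: "\<phi> t0 = pi / 2" using \<open>surj \<phi>\<close> by (metis surjD)
  have "z (t0 + S) \<noteq> z t0" if S: "0 < S" "S < 2 * pi / \<omega>" for S
  proof
    assume "z (t0 + S) = z t0"
    then have "sin (\<phi> (t0 + S)) = 1" using A(1) by (simp add: z_def t0)
    then obtain k :: int where k: "\<phi> (t0 + S) = of_int (2 * k) * pi + pi / 2"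
      unfolding sin_eq_1 by (auto simp: algebra_simps)
    have "\<phi> t0 < \<phi> (t0 + S)" "\<phi> (t0 + S) < \<phi> (t0 + 2 * pi / \<omega>)"
      using \<phi>(2) S by (auto simp: strict_mono_less)
    then have "0 * pi < of_int (2 * k) * pi" "of_int (2 * k) * pi < 2 * pi" by (auto simp: k \<phi>(4) t0)
    then have "0 < real_of_int (2 * k)" "real_of_int (2 * k) < 2"
      by (simp_all only: mult_less_cancel_right_pos pi_gt_zero)
    then show False by simp
  qed
  then have "minimal_period z (2 * pi / \<omega>)"
    using \<open>0 < \<omega>\<close> by (auto simp: minimal_period_def z_def \<phi>(4))
  with that 1 2 show ?thesis .
qed

end

section \<open>Pyramidal configurations over a balanced base\<close>

text \<open>Grouping by radius makes the weight \<open>h\<close> constant on each circle, where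
  balance applies.\<close>

lemma balanced_weighted_sum:
  assumes "finite I" "balanced I m q"
  shows "(\<Sum>i\<in>I. (m i * h (norm (q i))) *\<^sub>R q i) = 0"
proof -
  have "(\<Sum>i\<in>I. (m i * h (norm (q i))) *\<^sub>R q i)
      = (\<Sum>\<rho>\<in>(\<lambda>i. norm (q i)) ` I. \<Sum>i\<in>{i\<in>I. norm (q i) = \<rho>}. (m i * h (norm (q i))) *\<^sub>R q i)"
    by (rule sum.image_gen[OF \<open>finite I\<close>])
  also have "\<dots> = 0"
  proof (rule sum.neutral, rule ballI)
    fix \<rho> assume \<rho>: "\<rho> \<in> (\<lambda>i. norm (q i)) ` I"
    have "(\<Sum>i\<in>{i\<in>I. norm (q i) = \<rho>}. (m i * h (norm (q i))) *\<^sub>R q i)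
        = h \<rho> *\<^sub>R (\<Sum>i\<in>{i\<in>I. norm (q i) = \<rho>}. m i *\<^sub>R q i)"
      by (simp add: scaleR_right.sum mult.commute)
    also have "\<dots> = 0"
    \<comment> \<open>Balance speaks only of positive radii; at radius 0 every \<open>q i\<close> in
      the group is itself 0.\<close>
    proof (cases "\<rho> = 0")
      case False
      then have "0 < \<rho>" "{i\<in>I. norm (q i) = \<rho>} \<noteq> {}" using \<rho> by auto
      then show ?thesis using assms(2) unfolding balanced_def by auto
    qed (simp add: sum.neutral)
    finally show "(\<Sum>i\<in>{i\<in>I. norm (q i) = \<rho>}. (m i * h (norm (q i))) *\<^sub>R q i) = 0" .
  qed
  finally show ?thesis .
qed

text \<open>The massless apex exerts no force, so the base keeps its equations with constant
  \<open>lam\<close>. At the apex the horizontal force cancels by balance, and what remains is a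
  vertical equation comparing the stiffness at height \<open>c\<close> with
  \<open>lam\<close>.\<close>

lemma pyramidal_over_balanced_iff:
  fixes q :: "nat \<Rightarrow> real^3"
  assumes "n \<ge> 1"
    and mass: "\<And>i. i \<in> {1..n} \<Longrightarrow> 0 < m i"
    and planar: "\<And>i. i \<in> {1..n} \<Longrightarrow> q i $ 3 = 0"
    and com: "(\<Sum>i\<in>{1..n}. m i *\<^sub>R q i) = 0"
    and cc: "central_configuration {1..n} m q lam"
    and bal: "balanced {1..n} m q"
    and nz: "collisionless {1..n} q"
  shows "pyramidal_central_configuration n (m(0 := 0)) (q(0 := vector [0, 0, c])) \<longleftrightarrow>
     c \<noteq> 0 \<and> (\<Sum>i\<in>{1..n}. m i / sqrt ((norm (q i))\<^sup>2 + c\<^sup>2) ^ 3) = lam"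
    (is "pyramidal_central_configuration n ?m ?q \<longleftrightarrow> c \<noteq> 0 \<and> ?k = lam")
proof -
  define p :: "real^3" where "p = vector [0, 0, c]"
  have p3: "p $ 3 = c" and p12: "p $ 1 = 0" "p $ 2 = 0" by (auto simp: p_def)
  have I0: "{0..n} - {0} = {1..n}" by auto
  have dist: "norm (q i - p) = sqrt ((norm (q i))\<^sup>2 + c\<^sup>2)" if "i \<in> {1..n}" for i
    using planar[OF that] by (simp add: norm_vec_def L2_set_def sum_3 p3 p12)
  have base: "(\<Sum>i\<in>{0..n} - {j}. (?m i / norm (?q i - ?q j) ^ 3) *\<^sub>R (?q i - ?q j)) = - lam *\<^sub>R q j"
    if j: "j \<in> {1..n}" for j
  proof -
    have "(\<Sum>i\<in>{0..n} - {j}. (?m i / norm (?q i - ?q j) ^ 3) *\<^sub>R (?q i - ?q j))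
        = (\<Sum>i\<in>{1..n} - {j}. (m i / norm (q i - q j) ^ 3) *\<^sub>R (q i - q j))"
      using j by (intro sum.mono_neutral_cong_right) auto
    then show ?thesis using cc j by (simp add: central_configuration_def)
  qed
  have "(\<Sum>i\<in>{0..n} - {0}. (?m i / norm (?q i - ?q 0) ^ 3) *\<^sub>R (?q i - ?q 0))
      = (\<Sum>i\<in>{1..n}. (m i / sqrt ((norm (q i))\<^sup>2 + c\<^sup>2) ^ 3) *\<^sub>R (q i - p))"
    unfolding I0 by (intro sum.cong refl) (auto simp: dist p_def[symmetric])
  also have "\<dots> = (\<Sum>i\<in>{1..n}. (m i * (1 / sqrt ((norm (q i))\<^sup>2 + c\<^sup>2) ^ 3)) *\<^sub>R q i) - ?k *\<^sub>R p"
    by (simp add: scaleR_diff_right sum_subtractf scaleR_left.sum)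
  finally have apex: "(\<Sum>i\<in>{0..n} - {0}. (?m i / norm (?q i - ?q 0) ^ 3) *\<^sub>R (?q i - ?q 0)) = - ?k *\<^sub>R p"
    using balanced_weighted_sum[OF _ bal, of "\<lambda>\<rho>. 1 / sqrt (\<rho>\<^sup>2 + c\<^sup>2) ^ 3"] by simp
  show ?thesis
  proof
    assume pcc: "pyramidal_central_configuration n ?m ?q"
    then obtain lam' P where cc': "central_configuration {0..n} ?m ?q lam'"
      and P: "affine P" "?q ` {1..n} \<subseteq> P" "?q 0 \<notin> P"
      unfolding pyramidal_central_configuration_def by blast
    have qP: "q i \<in> P" if "i \<in> {1..n}" for i using P(2) that by force
    define M where "M = sum m {1..n}"
    have "0 < M" unfolding M_def using mass \<open>n \<ge> 1\<close> by (intro sum_pos) auto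
    \<comment> \<open>The plane \<open>P\<close> is arbitrary, and a collinear base would not
      determine it. It still contains the center of mass, a convex combination of base points, so
      the apex is not the origin.\<close>
    have "(\<Sum>i\<in>{1..n}. (m i / M) *\<^sub>R q i) \<in> P"
      using mass \<open>0 < M\<close> qP
      by (intro convex_sum affine_imp_convex P(1))
        (simp_all add: sum_divide_distrib[symmetric] less_imp_le, simp add: M_def)
    moreover have "(\<Sum>i\<in>{1..n}. (m i / M) *\<^sub>R q i) = (1 / M) *\<^sub>R (\<Sum>i\<in>{1..n}. m i *\<^sub>R q i)"
      by (simp add: scaleR_right.sum)
    ultimately have "0 \<in> P" unfolding com by simp
    then have "p \<noteq> 0" using P(3) by (auto simp: p_def)
    have eq: "\<forall>j\<in>{0..n}. (\<Sum>i\<in>{0..n} - {j}. (?m i / norm (?q i - ?q j) ^ 3) *\<^sub>R (?q i - ?q j)) = - lam' *\<^sub>R ?q j"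
      using cc' unfolding central_configuration_def by blast
    \<comment> \<open>A base point away from the origin forces the constant of the pyramid to agree
      with that of the base.\<close>
    have "- lam *\<^sub>R q 1 = - lam' *\<^sub>R ?q 1"
      by (rule trans[OF base[of 1, symmetric] bspec[OF eq]]) (use \<open>n \<ge> 1\<close> in auto)
    then have "- lam *\<^sub>R q 1 = - lam' *\<^sub>R q 1" by simp
    moreover have "q 1 \<noteq> 0" using nz \<open>n \<ge> 1\<close> by (simp add: collisionless_def)
    ultimately have "lam' = lam" by simp
    moreover have "- ?k *\<^sub>R p = - lam' *\<^sub>R p"
      using bspec[OF eq, of 0] unfolding apex by (simp add: p_def)
    ultimately have "?k = lam" using \<open>p \<noteq> 0\<close> by simp
    moreover have "c \<noteq> 0" using \<open>p \<noteq> 0\<close> by (auto simp: vec_eq_iff forall_3 p3 p12)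
    ultimately show "c \<noteq> 0 \<and> ?k = lam" by simp
  next
    assume c: "c \<noteq> 0 \<and> ?k = lam"
    have "p \<noteq> q i" if "i \<in> {1..n}" for i using planar[OF that] p3 c by auto
    then have "p \<notin> q ` {1..n}" by blast
    moreover have "inj_on q {1..n}" using cc unfolding central_configuration_def by blast
    moreover have "?q ` {1..n} = q ` {1..n}" by (rule image_cong) auto
    moreover have "inj_on ?q {1..n} \<longleftrightarrow> inj_on q {1..n}" by (rule inj_on_cong) auto
    moreover have "{0..n} = insert 0 {1..n}" "{1..n} - {0} = {1..n}" by auto
    moreover have "?q 0 = p" by (simp add: p_def)
    ultimately have "inj_on ?q {0..n}" by (simp only: inj_on_insert simp_thms)
    moreover have "(\<Sum>i\<in>{0..n} - {j}. (?m i / norm (?q i - ?q j) ^ 3) *\<^sub>R (?q i - ?q j)) = - lam *\<^sub>R ?q j"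
      if "j \<in> {0..n}" for j
    proof (cases "j = 0")
      case True
      then show ?thesis using c apex by (simp only: fun_upd_same p_def)
    next
      case False
      show ?thesis by (rule trans[OF base[of j]]) (use that False in auto)
    qed
    ultimately have "central_configuration {0..n} ?m ?q lam"
      unfolding central_configuration_def by blast
    moreover define P :: "(real^3) set" where "P = {x. axis 3 1 \<bullet> x = 0}"
    have "affine P" "aff_dim P = 2"
      by (auto simp: P_def affine_hyperplane axis_eq_0_iff)
    moreover have "?q ` {1..n} \<subseteq> P" "?q 0 \<notin> P"
      using planar c by (auto simp: P_def inner_axis' p_def[symmetric] p3)
    ultimately show "pyramidal_central_configuration n ?m ?q"
      unfolding pyramidal_central_configuration_def by blast
  qed
qed

section \<open>Both sides of the equivalence reduced to the stiffness condition\<close>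

theorem proposition1:
  fixes n :: nat and m :: "nat \<Rightarrow> real" and q :: "nat \<Rightarrow> real^3" and lam T :: real
  assumes "n \<ge> 2"
    and "\<forall>i\<in>{1..n}. 0 < m i"
    and "\<forall>i\<in>{1..n}. q i $ 3 = 0"
    and "(\<Sum>i\<in>{1..n}. m i *\<^sub>R q i) = 0"
    and "central_configuration {1..n} m q lam"
    and "balanced {1..n} m q"
    and "collisionless {1..n} q"
    and "minimal_period (rigid_motion {1..n} lam q) T"
  shows "(\<exists>z. synchronous_solution {1..n} m q T z) \<longleftrightarrow>
         (\<exists>c. pyramidal_central_configuration n (m(0 := 0)) (q(0 := vector [0, 0, c])))"
proof -
  have lam: "0 < lam"
    using central_configuration_lam_pos[OF assms(5)] assms(1,2) by auto
  have "q 1 \<noteq> 0" "q 1 $ 3 = 0" using assms(1,3,7) by (auto simp: collisionless_def)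
  then have T: "T = 2 * pi / sqrt lam"
    using rigid_motion_minimal_period[OF lam, of 1 "{1..n}" q T] assms(1,8) by auto
  interpret axial_field "{1..n}" m "\<lambda>i. norm (q i)"
    using assms(1,2,7) by unfold_locales (auto simp: collisionless_def)
  \<comment> \<open>Matches the exponent 3/2 of \<open>axis_solution\<close> with the cubed square
    roots in \<open>stiffness\<close>.\<close>
  have force: "- (\<Sum>i\<in>{1..n}. m i * x / ((norm (q i))\<^sup>2 + x\<^sup>2) powr (3/2)) = - (stiffness x * x)" for x
    unfolding stiffness_def sum_distrib_right by (simp add: powr_three_halves)
  have "(\<exists>z. synchronous_solution {1..n} m q T z) \<longleftrightarrow> (sqrt lam)\<^sup>2 < stiffness 0"
  proof
    assume "\<exists>z. synchronous_solution {1..n} m q T z"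
    then obtain z where z: "synchronous_solution {1..n} m q T z" by blast
    then obtain v where zv: "\<And>t. (z has_real_derivative v t) (at t)"
      "\<And>t. (v has_real_derivative - (stiffness (z t) * z t)) (at t)"
      unfolding synchronous_solution_def axis_solution_def force by blast
    show "(sqrt lam)\<^sup>2 < stiffness 0"
      using z lam by (intro periodic_solution_imp_stiff[OF zv])
        (auto simp: synchronous_solution_def minimal_period_def T)
  next
    assume "(sqrt lam)\<^sup>2 < stiffness 0"
    then obtain z v where zv: "\<And>t. (z has_real_derivative v t) (at t)"
      "\<And>t. (v has_real_derivative - (stiffness (z t) * z t)) (at t)"
      and per: "minimal_period z (2 * pi / sqrt lam)"
      using stiff_imp_periodic_solution[of "sqrt lam"] lam by (metis real_sqrt_gt_zero)
    \<comment> \<open>A constant function also has period \<open>T / 2\<close>, contradicting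
      minimality.\<close>
    have "\<not> (\<exists>k. \<forall>t. z t = k)"
    proof
      assume "\<exists>k. \<forall>t. z t = k"
      then have "z (t + T / 2) = z t" for t by metis
      then show False
        using per T by (auto simp: minimal_period_def dest!: spec[of _ "T / 2"])
    qed
    then have "synchronous_solution {1..n} m q T z"
      using zv per unfolding synchronous_solution_def axis_solution_def force T by blast
    then show "\<exists>z. synchronous_solution {1..n} m q T z" by blast
  qed
  also have "\<dots> \<longleftrightarrow> (\<exists>c. c \<noteq> 0 \<and> stiffness c = (sqrt lam)\<^sup>2)"
    using stiffness_attains_iff[of "sqrt lam"] lam by simp
  also have "\<dots> \<longleftrightarrow> (\<exists>c. pyramidal_central_configuration n (m(0 := 0)) (q(0 := vector [0, 0, c])))"
    using pyramidal_over_balanced_iff[of n m q lam] assms lam unfolding stiffness_def by simp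
  finally show ?thesis .
qed

end
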